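(* Let $M\ge1$ be an integer, let $p(\cdot)$ be a probability mass function on $\{1,\dots,M\}$, let $U_0,U_1\in\mathbb{C}^{M\times M}$ be unitary, and let $f_1,f_2$ be measurement factors with finite outcome sets $\mathcal{Y}_1,\mathcal{Y}_2$, each of the basic projection type or of the general type (defined in the context). For $y_1\in\mathcal{Y}_1$, $y_2\in\mathcal{Y}_2$ define $$p(y_1,y_2)=\sum p(x_0)\,U_0(x_1,x_0)\,\overline{U_0(x_1',x_0)}\;f_1(x_1,x_1',\tilde x_1,\tilde x_1',y_1)\;U_1(x_2,\tilde x_1)\,\overline{U_1(x_2',\tilde x_1')}\;f_2(x_2,x_2',\tilde x_2,\tilde x_2',y_2)\;f_=(\tilde x_2,\tilde x_2'),$$ where the sum is over all $x_0,x_1,x_1',\tilde x_1,\tilde x_1',x_2,x_2',\tilde x_2,\tilde x_2'\in\{1,\dots,M\}$. Then $p(y_1,y_2)$ is a properly normalized probability mass function on $\mathcal{Y}_1\times\mathcal{Y}_2$, i.e., $p(y_1,y_2)$ is real and nonnegative for all $(y_1,y_2)$ and $$\sum_{y_1\in\mathcal{Y}_1}\sum_{y_2\in\mathcal{Y}_2}p(y_1,y_2)=1.$$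
   Context: A matrix $A\in\mathbb{C}^{M\times M}$ is viewed as a function $(x,y)\mapsto A(x,y)$, with row index $x$ and column index $y$. $A^{\mathsf H}$ is the Hermitian transpose, $\overline{\,\cdot\,}$ is complex conjugation, and $I$ is the identity matrix. The equality constraint function is $f_=(x,x')=1$ if $x=x'$ and $0$ otherwise. Measurement factors. A measurement with outcome variable $y_k$ in a finite set $\mathcal{Y}_k$ is a function $f_k(x_k,x_k',\tilde x_k,\tilde x_k',y_k)$ with $x_k,x_k',\tilde x_k,\tilde x_k'\in\{1,\dots,M\}$, of one of two types. (i) Basic projection type: $\mathcal{Y}_k=\{1,\dots,M\}$, and for some unitary $B_k\in\mathbb{C}^{M\times M}$, $$f_k(x_k,x_k',\tilde x_k,\tilde x_k',y)=B_k(\tilde x_k,y)\,\overline{B_k(x_k,y)}\;B_k(x_k',y)\,\overline{B_k(\tilde x_k',y)}.$$ (ii) General type: $\mathcal{Y}_k$ is any finite set, and there are matrices $A_k(y)\in\mathbb{C}^{M\times M}$, $y\in\mathcal{Y}_k$, with $\sum_{y\in\mathcal{Y}_k}A_k(y)^{\mathsf H}A_k(y)=I$, such that $$f_k(x_k,x_k',\tilde x_k,\tilde x_k',y)=A_k(y)(\tilde x_k,x_k)\;\overline{A_k(y)(\tilde x_k',x_k')}.$$ *)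

theory Defs
  imports "HOL-Analysis.Analysis" "HOL-Probability.Probability_Mass_Function"
begin

text \<open>
  The index set \<open>{1, \<dots>, M}\<close> is rendered as a finite type \<open>'m\<close> with \<open>M = CARD('m) \<ge> 1\<close>, and the
  entry \<open>A(x, y)\<close> (row \<open>x\<close>, column \<open>y\<close>) as \<open>A $ x $ y\<close>.
\<close>

definition hermitian_transpose :: "complex^'n^'m \<Rightarrow> complex^'m^'n" where
  "hermitian_transpose A = (\<chi> i j. cnj (A $ j $ i))"

definition unitary_matrix :: "complex^'m::finite^'m \<Rightarrow> bool" where
  "unitary_matrix U \<longleftrightarrow>
     hermitian_transpose U ** U = mat 1 \<and> U ** hermitian_transpose U = mat 1"

definition eq_factor :: "'m \<Rightarrow> 'm \<Rightarrow> complex" where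
  "eq_factor x x' = (if x = x' then 1 else 0)"

text \<open>
  The arguments of a factor are \<open>x\<close>, \<open>x'\<close>, \<open>xt\<close>, \<open>xt'\<close>, \<open>y\<close> in this order, with \<open>xt\<close>, \<open>xt'\<close> for \<open>x\<close>, \<open>x'\<close>
  with a tilde. A basic projection measurement has
  the index set itself as its outcome set, a general one an arbitrary finite set. So that one
  type serves both, outcomes live in \<open>'m + 'a\<close>: the index set is \<open>range Inl\<close>, and finite sets of
  elements of an arbitrary type \<open>'a\<close> are available through \<open>Inr\<close>.
\<close>

type_synonym ('m, 'y) factor = "'m \<Rightarrow> 'm \<Rightarrow> 'm \<Rightarrow> 'm \<Rightarrow> 'y \<Rightarrow> complex"

definition basic_projection_factor ::
    "('m::finite + 'a) set \<Rightarrow> ('m, 'm + 'a) factor \<Rightarrow> bool" where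
  "basic_projection_factor Y f \<longleftrightarrow>
     Y = range Inl \<and>
     (\<exists>B :: complex^'m^'m. unitary_matrix B \<and>
        (\<forall>x x' xt xt' y. f x x' xt xt' (Inl y) =
           B $ xt $ y * cnj (B $ x $ y) * (B $ x' $ y * cnj (B $ xt' $ y))))"

definition general_factor :: "'y set \<Rightarrow> ('m::finite, 'y) factor \<Rightarrow> bool" where
  "general_factor Y f \<longleftrightarrow>
     finite Y \<and>
     (\<exists>A :: 'y \<Rightarrow> complex^'m^'m.
        (\<Sum>y\<in>Y. hermitian_transpose (A y) ** A y) = mat 1 \<and>
        (\<forall>x x' xt xt'. \<forall>y\<in>Y. f x x' xt xt' y = A y $ xt $ x * cnj (A y $ xt' $ x')))"

definition measurement_factor ::
    "('m::finite + 'a) set \<Rightarrow> ('m, 'm + 'a) factor \<Rightarrow> bool" where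
  "measurement_factor Y f \<longleftrightarrow> basic_projection_factor Y f \<or> general_factor Y f"

definition joint ::
    "'m::finite pmf \<Rightarrow> complex^'m^'m \<Rightarrow> ('m, 'y) factor \<Rightarrow>
     complex^'m^'m \<Rightarrow> ('m, 'z) factor \<Rightarrow> 'y \<Rightarrow> 'z \<Rightarrow> complex" where
  "joint p U0 f1 U1 f2 y1 y2 =
     (\<Sum>x0\<in>UNIV. \<Sum>x1\<in>UNIV. \<Sum>x1'\<in>UNIV. \<Sum>xt1\<in>UNIV. \<Sum>xt1'\<in>UNIV.
      \<Sum>x2\<in>UNIV. \<Sum>x2'\<in>UNIV. \<Sum>xt2\<in>UNIV. \<Sum>xt2'\<in>UNIV.
        complex_of_real (pmf p x0) * U0 $ x1 $ x0 * cnj (U0 $ x1' $ x0) *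
        f1 x1 x1' xt1 xt1' y1 *
        U1 $ x2 $ xt1 * cnj (U1 $ x2' $ xt1') *
        f2 x2 x2' xt2 xt2' y2 *
        eq_factor xt2 xt2')"

end

theory Submission
  imports Defs
begin

text \<open>
  A basic projection measurement is the general measurement with the rank-one projections
  \<open>A(y)(x, x') = B(x, y) cnj(B(x', y))\<close>. For general measurements the sum defining \<open>p(y\<^sub>1, y\<^sub>2)\<close>
  factors through \<open>K = A\<^sub>2(y\<^sub>2) U\<^sub>1 A\<^sub>1(y\<^sub>1) U\<^sub>0\<close>: it is the \<open>p\<close>-average of the diagonal of \<open>K\<^sup>H K\<close>.
  Diagonal entries of \<open>K\<^sup>H K\<close> are squared column norms, hence nonnegative, and summing \<open>K\<^sup>H K\<close>
  first over \<open>y\<^sub>2\<close> and then over \<open>y\<^sub>1\<close> collapses it to the identity matrix.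
\<close>

lemma hermitian_transpose_mult:
  "hermitian_transpose (A ** B) = hermitian_transpose B ** hermitian_transpose A"
  by (simp add: vec_eq_iff hermitian_transpose_def matrix_matrix_mult_def mult.commute)

lemma hermitian_transpose_mult_self_diag:
  "(hermitian_transpose K ** K) $ i $ i = (\<Sum>k\<in>UNIV. K $ k $ i * cnj (K $ k $ i))"
  by (simp add: hermitian_transpose_def matrix_matrix_mult_def mult.commute)

lemma sum_matrix_mult_left:
  fixes B :: "'a::semiring_1^'n::finite^'m"
  shows "(\<Sum>y\<in>Y. B ** A y) = B ** (\<Sum>y\<in>Y. A y)"
  by (simp add: vec_eq_iff matrix_matrix_mult_def sum_distrib_left sum.swap[of _ _ Y])

lemma sum_matrix_mult_right:
  fixes B :: "'a::semiring_1^'k^'n::finite"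
  shows "(\<Sum>y\<in>Y. A y ** B) = (\<Sum>y\<in>Y. A y) ** B"
  by (simp add: vec_eq_iff matrix_matrix_mult_def sum_distrib_right sum.swap[of _ _ Y])

text \<open>The outer factors \<open>W^H\<close> and \<open>W\<close> do not depend on
  \<open>y\<close>, so distributivity leaves only the completeness sum between them. This is what
  discards a measurement once its outcome is summed out.\<close>

lemma sum_hermitian_square_mult:
  fixes A :: "'y \<Rightarrow> complex^'n::finite^'m::finite" and W :: "complex^'k^'n"
  assumes "(\<Sum>y\<in>Y. hermitian_transpose (A y) ** A y) = mat 1"
  shows "(\<Sum>y\<in>Y. hermitian_transpose (A y ** W) ** (A y ** W)) = hermitian_transpose W ** W"
proof -
  have "(\<Sum>y\<in>Y. hermitian_transpose (A y ** W) ** (A y ** W)) =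
      (\<Sum>y\<in>Y. hermitian_transpose W ** ((hermitian_transpose (A y) ** A y) ** W))"
    by (simp add: hermitian_transpose_mult matrix_mul_assoc)
  also have "\<dots> = hermitian_transpose W ** W"
    by (simp add: sum_matrix_mult_left sum_matrix_mult_right assms)
  finally show ?thesis .
qed

text \<open>A unitary is a general measurement with a single outcome.\<close>

lemma unitary_hermitian_square_mult:
  assumes "unitary_matrix U"
  shows "hermitian_transpose (U ** W) ** (U ** W) = hermitian_transpose W ** W"
  using sum_hermitian_square_mult[where Y = "{()}" and A = "\<lambda>_. U" and W = W] assms
  by (simp add: unitary_matrix_def)

text \<open>Both halves of unitarity enter: the columns of \<open>B\<close> have norm 1, so each
  \<open>P y\<close> is a projection with \<open>P^H P = P\<close>, and the sum of these projections
  is \<open>B B^H = I\<close>.\<close>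

lemma sum_rank_one_projections:
  fixes B :: "complex^'m::finite^'m"
  assumes "unitary_matrix B"
  defines "P \<equiv> \<lambda>y. \<chi> i j. B $ i $ y * cnj (B $ j $ y)"
  shows "(\<Sum>y\<in>UNIV. hermitian_transpose (P y) ** P y) = mat 1"
proof -
  have norm: "(\<Sum>k\<in>UNIV. B $ k $ y * cnj (B $ k $ y)) = 1" for y
    using assms(1) hermitian_transpose_mult_self_diag[of B y]
    by (simp add: unitary_matrix_def mat_def)
  have "(hermitian_transpose (P y) ** P y) $ i $ j =
      (\<Sum>k\<in>UNIV. B $ k $ y * cnj (B $ k $ y)) * (B $ i $ y * cnj (B $ j $ y))" for y i j
    by (simp add: P_def hermitian_transpose_def matrix_matrix_mult_def sum_distrib_left mult_ac)
  then have "(\<Sum>y\<in>UNIV. hermitian_transpose (P y) ** P y) = B ** hermitian_transpose B"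
    by (simp add: vec_eq_iff norm)
      (simp add: hermitian_transpose_def matrix_matrix_mult_def)
  with assms(1) show ?thesis
    by (simp add: unitary_matrix_def)
qed

lemma basic_projection_imp_general_factor:
  assumes "basic_projection_factor Y f"
  shows "general_factor Y f"
proof -
  from assms obtain B where Y: "Y = range Inl" and B: "unitary_matrix B"
    and f: "\<And>x x' xt xt' y. f x x' xt xt' (Inl y) =
      B $ xt $ y * cnj (B $ x $ y) * (B $ x' $ y * cnj (B $ xt' $ y))"
    unfolding basic_projection_factor_def by blast
  define P where "P = (\<lambda>y. \<chi> i j. B $ i $ y * cnj (B $ j $ y))"
  \<comment> \<open>\<open>projl\<close> undoes the tag \<open>Inl\<close>; its values elsewhere do
    not matter because \<open>Y\<close> is \<open>range Inl\<close>.\<close>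
  have "(\<Sum>y\<in>Y. hermitian_transpose (P (projl y)) ** P (projl y)) = mat 1"
    using sum_rank_one_projections[OF B] by (simp add: Y P_def sum.reindex)
  moreover have "\<forall>x x' xt xt'. \<forall>y\<in>Y.
      f x x' xt xt' y = P (projl y) $ xt $ x * cnj (P (projl y) $ xt' $ x')"
    by (auto simp: Y f P_def)
  ultimately show ?thesis
    unfolding general_factor_def
    by (intro conjI exI[of _ "\<lambda>y. P (projl y)"]) (simp_all add: Y)
qed

lemma sum_swap_pairs:
  "(\<Sum>a\<in>A. \<Sum>b\<in>B. \<Sum>c\<in>C. \<Sum>d\<in>D. h a b c d) = (\<Sum>c\<in>C. \<Sum>d\<in>D. \<Sum>a\<in>A. \<Sum>b\<in>B. h a b c d)"
  by (simp only: sum.swap[of _ C A] sum.swap[of _ C B] sum.swap[of _ D A] sum.swap[of _ D B])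

text \<open>One step of contracting the factor graph: the sum over \<open>x\<close> is a matrix
  product and the sum over \<open>x'\<close> its conjugate copy. The kernel \<open>G\<close> is
  arbitrary, so it can hold all sums still to be contracted and the step can be iterated.\<close>

lemma sum_absorb_column:
  fixes C :: "complex^'m::finite^'n::finite" and W :: "complex^'k^'m"
  shows "(\<Sum>x\<in>UNIV. \<Sum>x'\<in>UNIV. W $ x $ j * cnj (W $ x' $ j) *
           (\<Sum>z\<in>UNIV. \<Sum>z'\<in>UNIV. C $ z $ x * cnj (C $ z' $ x') * G z z')) =
         (\<Sum>z\<in>UNIV. \<Sum>z'\<in>UNIV. (C ** W) $ z $ j * cnj ((C ** W) $ z' $ j) * G z z')"
    (is "?lhs = ?rhs")
proof -
  have "?lhs = (\<Sum>x\<in>UNIV. \<Sum>x'\<in>UNIV. \<Sum>z\<in>UNIV. \<Sum>z'\<in>UNIV.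
      (C $ z $ x * W $ x $ j) * cnj (C $ z' $ x' * W $ x' $ j) * G z z')"
    by (simp add: sum_distrib_left mult_ac)
  also have "\<dots> = (\<Sum>z\<in>UNIV. \<Sum>z'\<in>UNIV. \<Sum>x\<in>UNIV. \<Sum>x'\<in>UNIV.
      (C $ z $ x * W $ x $ j) * cnj (C $ z' $ x' * W $ x' $ j) * G z z')"
    by (rule sum_swap_pairs)
  also have "\<dots> = ?rhs"
    by (simp add: matrix_matrix_mult_def sum_product) (simp add: sum_distrib_right)
  finally show ?thesis .
qed

lemma joint_eq_expectation_diag:
  fixes U0 U1 A1 A2 :: "complex^'m::finite^'m"
  assumes "\<And>x x' xt xt'. f1 x x' xt xt' y1 = A1 $ xt $ x * cnj (A1 $ xt' $ x')"
    and "\<And>x x' xt xt'. f2 x x' xt xt' y2 = A2 $ xt $ x * cnj (A2 $ xt' $ x')"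
  defines "K \<equiv> A2 ** (U1 ** (A1 ** U0))"
  shows "joint p U0 f1 U1 f2 y1 y2 =
    (\<Sum>x\<in>UNIV. complex_of_real (pmf p x) * (hermitian_transpose K ** K) $ x $ x)"
proof -
  have "joint p U0 f1 U1 f2 y1 y2 = (\<Sum>x0\<in>UNIV. complex_of_real (pmf p x0) *
     (\<Sum>x1\<in>UNIV. \<Sum>x1'\<in>UNIV. U0 $ x1 $ x0 * cnj (U0 $ x1' $ x0) *
     (\<Sum>xt1\<in>UNIV. \<Sum>xt1'\<in>UNIV. A1 $ xt1 $ x1 * cnj (A1 $ xt1' $ x1') *
     (\<Sum>x2\<in>UNIV. \<Sum>x2'\<in>UNIV. U1 $ x2 $ xt1 * cnj (U1 $ x2' $ xt1') *
     (\<Sum>xt2\<in>UNIV. \<Sum>xt2'\<in>UNIV. A2 $ xt2 $ x2 * cnj (A2 $ xt2' $ x2') *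
      eq_factor xt2 xt2')))))"
    by (simp add: joint_def assms(1,2) sum_distrib_left mult.assoc)
  \<comment> \<open>Starting from \<open>W = U0\<close>, the absorption step is applied with
    \<open>C\<close> equal to \<open>A1\<close>, \<open>U1\<close> and \<open>A2\<close> in turn,
    which produces the bracketing of \<open>K\<close>.\<close>
  also have "\<dots> = (\<Sum>x0\<in>UNIV. complex_of_real (pmf p x0) *
     (\<Sum>xt2\<in>UNIV. \<Sum>xt2'\<in>UNIV. K $ xt2 $ x0 * cnj (K $ xt2' $ x0) * eq_factor xt2 xt2'))"
    by (simp only: sum_absorb_column K_def)
  \<comment> \<open>The equality factor identifies the two last indices, leaving the squared norm of
    a column of \<open>K\<close>.\<close>
  also have "\<dots> = (\<Sum>x\<in>UNIV. complex_of_real (pmf p x) * (hermitian_transpose K ** K) $ x $ x)"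
    by (simp add: eq_factor_def hermitian_transpose_mult_self_diag if_distrib sum.delta cong: if_cong)
  finally show ?thesis .
qed

theorem proposition2:
  fixes p :: "'m::finite pmf"
    and U0 U1 :: "complex^'m^'m"
    and Y1 :: "('m + 'a) set" and Y2 :: "('m + 'b) set"
    and f1 :: "('m, 'm + 'a) factor" and f2 :: "('m, 'm + 'b) factor"
  assumes "unitary_matrix U0" and "unitary_matrix U1"
    and "measurement_factor Y1 f1" and "measurement_factor Y2 f2"
  shows "(\<forall>y1\<in>Y1. \<forall>y2\<in>Y2.
            joint p U0 f1 U1 f2 y1 y2 \<in> \<real> \<and> 0 \<le> Re (joint p U0 f1 U1 f2 y1 y2)) \<and>
         (\<Sum>y1\<in>Y1. \<Sum>y2\<in>Y2. joint p U0 f1 U1 f2 y1 y2) = 1"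
proof -
  have general: "general_factor Y1 f1" "general_factor Y2 f2"
    using assms(3,4) basic_projection_imp_general_factor
    unfolding measurement_factor_def by blast+
  from general(1) obtain A1
    where A1: "(\<Sum>y\<in>Y1. hermitian_transpose (A1 y) ** A1 y) = mat 1"
      and f1: "\<And>x x' xt xt' y. y \<in> Y1 \<Longrightarrow> f1 x x' xt xt' y = A1 y $ xt $ x * cnj (A1 y $ xt' $ x')"
    unfolding general_factor_def by blast
  from general(2) obtain A2
    where A2: "(\<Sum>y\<in>Y2. hermitian_transpose (A2 y) ** A2 y) = mat 1"
      and f2: "\<And>x x' xt xt' y. y \<in> Y2 \<Longrightarrow> f2 x x' xt xt' y = A2 y $ xt $ x * cnj (A2 y $ xt' $ x')"
    unfolding general_factor_def by blast
  define K where "K y1 y2 = A2 y2 ** (U1 ** (A1 y1 ** U0))" for y1 y2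
  \<comment> \<open>\<open>E S\<close> is the trace of \<open>S\<close> against the diagonal density
    matrix with entries \<open>pmf p x\<close>.\<close>
  define E where "E S = (\<Sum>x\<in>UNIV. complex_of_real (pmf p x) * S $ x $ x)" for S :: "complex^'m^'m"
  have joint: "joint p U0 f1 U1 f2 y1 y2 = E (hermitian_transpose (K y1 y2) ** K y1 y2)"
    if "y1 \<in> Y1" "y2 \<in> Y2" for y1 y2
    unfolding K_def E_def using that by (intro joint_eq_expectation_diag f1 f2)
  \<comment> \<open>The index type is left free so that this serves both outcome sets.\<close>
  have E_sum: "(\<Sum>y\<in>Y. E (S y)) = E (\<Sum>y\<in>Y. S y)" for S and Y :: "'y set"
    by (simp add: E_def sum_distrib_left sum.swap[of _ _ Y])
  have "E (hermitian_transpose L ** L) = complex_of_real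
      (\<Sum>x\<in>UNIV. pmf p x * (\<Sum>k\<in>UNIV. (cmod (L $ k $ x))\<^sup>2))" for L :: "complex^'m^'m"
    by (simp add: E_def hermitian_transpose_mult_self_diag flip: complex_norm_square)
  then have nonneg:
      "E (hermitian_transpose L ** L) \<in> \<real> \<and> 0 \<le> Re (E (hermitian_transpose L ** L))"
    for L :: "complex^'m^'m"
    by (simp only: Reals_of_real Re_complex_of_real) (simp add: sum_nonneg)
  have "(\<Sum>y1\<in>Y1. \<Sum>y2\<in>Y2. joint p U0 f1 U1 f2 y1 y2) =
      (\<Sum>y1\<in>Y1. \<Sum>y2\<in>Y2. E (hermitian_transpose (K y1 y2) ** K y1 y2))"
    by (intro sum.cong refl joint)
  also have "\<dots> = E (\<Sum>y1\<in>Y1. \<Sum>y2\<in>Y2. hermitian_transpose (K y1 y2) ** K y1 y2)"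
    by (simp only: E_sum)
  \<comment> \<open>The factors are stripped from the last to the first: for fixed \<open>y1\<close>
    the inner sum removes \<open>A2\<close>, unitarity removes \<open>U1\<close>, and the outer sum
    then removes \<open>A1\<close>.\<close>
  also have "(\<Sum>y1\<in>Y1. \<Sum>y2\<in>Y2. hermitian_transpose (K y1 y2) ** K y1 y2) =
      hermitian_transpose U0 ** U0"
    unfolding K_def
    by (simp only: sum_hermitian_square_mult[OF A2] unitary_hermitian_square_mult[OF assms(2)]
        sum_hermitian_square_mult[OF A1])
  also have "\<dots> = mat 1"
    using assms(1) by (simp add: unitary_matrix_def)
  also have "E (mat 1) = complex_of_real (\<Sum>x\<in>UNIV. pmf p x)"
    by (simp add: E_def mat_def)
  also have "\<dots> = 1"
    by (simp add: sum_pmf_eq_1)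
  finally show ?thesis
    using joint nonneg by simp
qed

end
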